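(* Let $s,n\in\mathbb{N}$, let $p\ge 3$ be a prime and let $k=(p^{s+1}-1)/(p-1)$. There exists a Kakeya set $S\subseteq(\mathbb{Z}/p^k\mathbb{Z})^n$ such that $$|S|\ \le\ \frac{p^{kn}}{k^{n-1}}\,(1-1/p)^{-n}.$$
   Context: The projective space $\mathbb{P}(\mathbb{Z}/p^k\mathbb{Z})^{n-1}$ is the set of vectors $u\in(\mathbb{Z}/p^k\mathbb{Z})^n$ having at least one unit coordinate, taken up to multiplication by units (its elements are called directions). A line in direction $u$ is a set $\{a+\lambda u:\lambda\in\mathbb{Z}/p^k\mathbb{Z}\}$ with $a\in(\mathbb{Z}/p^k\mathbb{Z})^n$. A Kakeya set is a set $S\subseteq(\mathbb{Z}/p^k\mathbb{Z})^n$ which contains a line in every direction. *)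

theory Defs
  imports Complex_Main "HOL-Number_Theory.Residues" "HOL-Library.FuncSet"
begin

text \<open>Vectors of length n over a commutative ring R are the extensional functions on
  \<open>{..<n}\<close> with values in the carrier of R.\<close>

definition vectors :: "('a, 'b) ring_scheme \<Rightarrow> nat \<Rightarrow> (nat \<Rightarrow> 'a) set" where
  "vectors R n = {..<n} \<rightarrow>\<^sub>E carrier R"

definition vec_scale :: "('a, 'b) ring_scheme \<Rightarrow> nat \<Rightarrow> 'a \<Rightarrow> (nat \<Rightarrow> 'a) \<Rightarrow> (nat \<Rightarrow> 'a)" where
  "vec_scale R n c u = (\<lambda>i\<in>{..<n}. c \<otimes>\<^bsub>R\<^esub> u i)"

definition vec_add :: "('a, 'b) ring_scheme \<Rightarrow> nat \<Rightarrow> (nat \<Rightarrow> 'a) \<Rightarrow> (nat \<Rightarrow> 'a) \<Rightarrow> (nat \<Rightarrow> 'a)" where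
  "vec_add R n u v = (\<lambda>i\<in>{..<n}. u i \<oplus>\<^bsub>R\<^esub> v i)"

definition unit_coord_vectors :: "('a, 'b) ring_scheme \<Rightarrow> nat \<Rightarrow> (nat \<Rightarrow> 'a) set" where
  "unit_coord_vectors R n = {u \<in> vectors R n. \<exists>i<n. u i \<in> Units R}"

definition same_direction :: "('a, 'b) ring_scheme \<Rightarrow> nat \<Rightarrow> ((nat \<Rightarrow> 'a) \<times> (nat \<Rightarrow> 'a)) set" where
  "same_direction R n = {(u, v). u \<in> unit_coord_vectors R n \<and> v \<in> unit_coord_vectors R n \<and>
     (\<exists>c\<in>Units R. v = vec_scale R n c u)}"

text \<open>The projective space of dimension n - 1 over R; its elements, the directions, are
  equivalence classes of vectors. The argument n is the number of coordinates.\<close>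

definition directions :: "('a, 'b) ring_scheme \<Rightarrow> nat \<Rightarrow> (nat \<Rightarrow> 'a) set set" where
  "directions R n = unit_coord_vectors R n // same_direction R n"

definition line :: "('a, 'b) ring_scheme \<Rightarrow> nat \<Rightarrow> (nat \<Rightarrow> 'a) \<Rightarrow> (nat \<Rightarrow> 'a) \<Rightarrow> (nat \<Rightarrow> 'a) set" where
  "line R n a u = {vec_add R n a (vec_scale R n l u) | l. l \<in> carrier R}"

text \<open>Any representative u of the direction D yields the same lines
  (lemma \<open>line_same_direction\<close>), so the choice of u is immaterial.\<close>

definition is_line_in_direction ::
  "('a, 'b) ring_scheme \<Rightarrow> nat \<Rightarrow> (nat \<Rightarrow> 'a) set \<Rightarrow> (nat \<Rightarrow> 'a) set \<Rightarrow> bool" where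
  "is_line_in_direction R n D L \<longleftrightarrow> (\<exists>u\<in>D. \<exists>a\<in>vectors R n. L = line R n a u)"

definition is_kakeya_set :: "('a, 'b) ring_scheme \<Rightarrow> nat \<Rightarrow> (nat \<Rightarrow> 'a) set \<Rightarrow> bool" where
  "is_kakeya_set R n S \<longleftrightarrow> S \<subseteq> vectors R n \<and>
     (\<forall>D\<in>directions R n. \<exists>L. is_line_in_direction R n D L \<and> L \<subseteq> S)"

lemma vec_scale_scale:
  assumes "cring R" "u \<in> vectors R n" "c \<in> carrier R" "d \<in> carrier R"
  shows "vec_scale R n d (vec_scale R n c u) = vec_scale R n (d \<otimes>\<^bsub>R\<^esub> c) u"
proof -
  interpret cring R by fact
  show ?thesis
    using assms(2-4) by (fastforce simp: vec_scale_def vectors_def m_assoc PiE_iff intro!: restrict_ext)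
qed

lemma vec_scale_one:
  assumes "cring R" "u \<in> vectors R n"
  shows "vec_scale R n \<one>\<^bsub>R\<^esub> u = u"
proof -
  interpret cring R by fact
  show ?thesis
  proof
    fix i show "vec_scale R n \<one>\<^bsub>R\<^esub> u i = u i"
      using assms(2) by (cases "i < n") (auto simp: vec_scale_def vectors_def PiE_iff extensional_def)
  qed
qed

lemma equiv_same_direction:
  assumes "cring R"
  shows "equiv (unit_coord_vectors R n) (same_direction R n)"
proof -
  interpret cring R by fact
  have V: "u \<in> vectors R n" if "u \<in> unit_coord_vectors R n" for u
    using that by (simp add: unit_coord_vectors_def)
  show ?thesis
  proof (rule equivI)
    show "same_direction R n \<subseteq> unit_coord_vectors R n \<times> unit_coord_vectors R n"
      by (auto simp: same_direction_def)
    show "refl_on (unit_coord_vectors R n) (same_direction R n)"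
      using vec_scale_one[OF assms V, symmetric] Units_one_closed
      by (fastforce simp: refl_on_def same_direction_def)
    show "sym (same_direction R n)"
    proof (rule symI)
      fix u v assume "(u, v) \<in> same_direction R n"
      then obtain c where uv: "u \<in> unit_coord_vectors R n" "v \<in> unit_coord_vectors R n"
        and c: "c \<in> Units R" "v = vec_scale R n c u"
        by (auto simp: same_direction_def)
      have "vec_scale R n (inv\<^bsub>R\<^esub> c) v = u"
        using vec_scale_scale[OF assms V[OF uv(1)], of c "inv\<^bsub>R\<^esub> c"] c
          vec_scale_one[OF assms V[OF uv(1)]] Units_closed[OF c(1)] by simp
      with uv c show "(v, u) \<in> same_direction R n"
        unfolding same_direction_def by (auto intro!: bexI[of _ "inv\<^bsub>R\<^esub> c"])
    qed
    show "trans (same_direction R n)"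
    proof (rule transI)
      fix u v w assume "(u, v) \<in> same_direction R n" "(v, w) \<in> same_direction R n"
      then obtain c d where uv: "u \<in> unit_coord_vectors R n" "w \<in> unit_coord_vectors R n"
        and c: "c \<in> Units R" "v = vec_scale R n c u" "d \<in> Units R" "w = vec_scale R n d v"
        by (auto simp: same_direction_def)
      have "w = vec_scale R n (d \<otimes>\<^bsub>R\<^esub> c) u"
        using vec_scale_scale[OF assms V[OF uv(1)], of c d] c Units_closed by auto
      with uv c show "(u, w) \<in> same_direction R n"
        unfolding same_direction_def by (auto intro!: bexI[of _ "d \<otimes>\<^bsub>R\<^esub> c"])
    qed
  qed
qed

lemma line_same_direction:
  assumes "cring R" "(u, v) \<in> same_direction R n"
  shows "line R n a u = line R n a v"
proof -
  interpret cring R by fact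
  have sub: "line R n a v \<subseteq> line R n a u" if uv: "(u, v) \<in> same_direction R n" for u v
  proof -
    obtain c where c: "c \<in> Units R" "v = vec_scale R n c u" "u \<in> vectors R n"
      using uv by (auto simp: same_direction_def unit_coord_vectors_def)
    have "vec_scale R n l v = vec_scale R n (l \<otimes>\<^bsub>R\<^esub> c) u" if "l \<in> carrier R" for l
      using vec_scale_scale[OF assms(1) c(3), of c l] c that Units_closed[OF c(1)] by simp
    then show ?thesis
      using c(1) by (fastforce simp: line_def)
  qed
  have "(v, u) \<in> same_direction R n"
    using equiv_same_direction[OF assms(1)] assms(2) by (meson equivE symD)
  then show ?thesis
    using sub assms(2) by blast
qed

end

theory Submission
  imports Defs
begin

text \<open>Choose a function \<open>\<phi>\<close> such that for every t the map \<open>u \<mapsto> \<phi> u + t u\<close> has an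
  image of size at most \<open>p ^ (k - s)\<close>, and on the multiples of p one of size at most
  \<open>p ^ (k - s - 1)\<close>. A direction whose last unit coordinate has index j is represented by a vector u
  with \<open>u j = 1\<close>, and it gets the line of the points with coordinates \<open>\<phi> (u i) + t u i\<close> for \<open>i \<noteq> j\<close>
  and t at index j. For fixed j and t, the coordinates below j range over a full image and those
  above j over an image of the multiples of p, so summing over j gives a geometric series.

  The function \<open>\<phi>\<close> replaces each base-p digit contribution \<open>d l * p ^ l\<close> of u by \<open>- c l * d l * p ^ l\<close>,
  whence \<open>\<phi> u + t u\<close> is the sum of the \<open>d l * p ^ l * (t - c l)\<close>. If
  \<open>c i, \<dots>, c (i + s - 1)\<close> agree with t modulo \<open>p ^ s, \<dots>, p\<close> respectively, then
  modulo \<open>p ^ (i + s)\<close> only the first i digits of u matter, which saves the factor \<open>p ^ s\<close>. The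
  post-order traversal of the p-ary tree of residues modulo \<open>1, p, \<dots>, p ^ s\<close>, which has k nodes,
  is a sequence c containing such a window for every t.\<close>

section \<open>Residue sequences with a window for every integer\<close>

lemma window_sequence:
  fixes p s :: nat
  assumes "p > 0"
  shows "\<exists>c :: nat \<Rightarrow> int. \<forall>t. \<exists>i. i + s < (\<Sum>j\<le>s. p ^ j) \<and> (\<forall>r<s. int p ^ (s - r) dvd t - c (i + r))"
proof (induction s)
  case 0
  show ?case by auto
next
  case (Suc s)
  define K where "K = (\<Sum>j\<le>s. p ^ j)"
  from Suc obtain c :: "nat \<Rightarrow> int"
    where c: "\<And>t. \<exists>i. i + s < K \<and> (\<forall>r<s. int p ^ (s - r) dvd t - c (i + r))"
    unfolding K_def by blast
  have K_Suc: "(\<Sum>j\<le>Suc s. p ^ j) = p * K + 1"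
    by (simp add: K_def sum.atMost_Suc_shift sum_distrib_left del: sum.atMost_Suc)
  \<comment> \<open>\<open>p\<close> copies of the shorter traversal, all terms of copy
    \<open>b\<close> being \<open>b\<close> modulo \<open>p\<close>, are followed by the root at
    index \<open>p * K\<close>, a residue modulo 1.\<close>
  define c' where "c' x = int (x div K) + int p * c (x mod K)" for x
  have "\<exists>i. i + Suc s < p * K + 1 \<and> (\<forall>r<Suc s. int p ^ (Suc s - r) dvd t - c' (i + r))" for t
  proof -
    define b where "b = nat (t mod int p)"
    have b: "int b = t mod int p" "b < p" using assms by (auto simp: b_def nat_less_iff)
    obtain i where i: "i + s < K" "\<And>r. r < s \<Longrightarrow> int p ^ (s - r) dvd t div int p - c (i + r)"
      using c by blast
    have diff: "t - c' (b * K + i + r) = int p * (t div int p - c (i + r))" if "r \<le> s" for r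
    proof -
      have "i + r < K" using i(1) that by simp
      then have "(b * K + i + r) div K = b" "(b * K + i + r) mod K = i + r"
        using div_mult_self3[of K b "i + r"] by (auto simp: add.assoc)
      then have "c' (b * K + i + r) = int b + int p * c (i + r)" by (simp add: c'_def)
      then show ?thesis using b(1) by (simp add: algebra_simps minus_mod_eq_mult_div[symmetric])
    qed
    have "Suc b * K \<le> p * K" using b(2) by (intro mult_right_mono) auto
    then have "b * K + i + Suc s < p * K + 1" using i(1) by simp
    moreover have "int p ^ (Suc s - r) dvd t - c' (b * K + i + r)" if "r < Suc s" for r
    proof (cases "r = s")
      \<comment> \<open>The induction hypothesis says nothing at \<open>r = s\<close>, but
        \<open>i + s < K\<close> keeps this index inside copy \<open>b\<close>, whose terms all
        agree with \<open>t\<close> modulo \<open>p\<close>.\<close>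
      case True
      then show ?thesis using diff[of r] by simp
    next
      case False
      then have "r < s" using that by simp
      then show ?thesis using diff[of r] i(2)[of r] by (simp add: Suc_diff_le mult_dvd_mono)
    qed
    ultimately show ?thesis by blast
  qed
  then show ?case unfolding K_Suc by blast
qed

section \<open>Digit shears and the sizes of their images\<close>

text \<open>The difference \<open>u mod p ^ (l + 1) - u mod p ^ l\<close> is the contribution of the base-p digit
  of index l to u.\<close>

definition digit_shear :: "int \<Rightarrow> (nat \<Rightarrow> int) \<Rightarrow> nat \<Rightarrow> int \<Rightarrow> int \<Rightarrow> int" where
  "digit_shear p c k t u = (\<Sum>l<k. (u mod p ^ Suc l - u mod p ^ l) * (t - c l))"

text \<open>The digit contributions of a reduced \<open>u\<close> telescope to \<open>u\<close>.
  Hence varying \<open>t\<close> traces one coordinate of a line, with direction coordinate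
  \<open>u\<close>.\<close>

lemma digit_shear_affine:
  assumes "0 \<le> u" "u < p ^ k"
  shows "digit_shear p c k t u = digit_shear p c k 0 u + t * u"
proof -
  have "(\<Sum>l<k. u mod p ^ Suc l - u mod p ^ l) = u"
    using assms by (subst sum_lessThan_telescope) simp
  then have "t * u = (\<Sum>l<k. (u mod p ^ Suc l - u mod p ^ l) * t)"
    by (metis mult.commute sum_distrib_right)
  then show ?thesis
    unfolding digit_shear_def by (simp add: sum.distrib[symmetric] algebra_simps)
qed

text \<open>The digit of index \<open>l\<close> contributes a multiple of \<open>p ^ l\<close>, and
  for \<open>i \<le> l < i + s\<close> the window supplies the missing factor
  \<open>p ^ (i + s - l)\<close>. So modulo \<open>p ^ (i + s)\<close> only the digits below
  \<open>i\<close> survive.\<close>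

lemma digit_shear_cong:
  assumes "i + s \<le> k" and win: "\<And>r. r < s \<Longrightarrow> p ^ (s - r) dvd t - c (i + r)"
  shows "digit_shear p c k t u mod p ^ (i + s) = digit_shear p c i t (u mod p ^ i) mod p ^ (i + s)"
proof -
  let ?g = "\<lambda>l. (u mod p ^ Suc l - u mod p ^ l) * (t - c l)"
  have "digit_shear p c k t u = (\<Sum>l<i. ?g l) + (\<Sum>l=i..<k. ?g l)"
    unfolding digit_shear_def using assms(1)
    by (simp add: sum.atLeastLessThan_concat lessThan_atLeast0)
  moreover have "(\<Sum>l<i. ?g l) = digit_shear p c i t (u mod p ^ i)"
    unfolding digit_shear_def
  proof (rule sum.cong[OF refl])
    fix l assume "l \<in> {..<i}"
    then have "p ^ Suc l dvd p ^ i" "p ^ l dvd p ^ i" by (intro le_imp_power_dvd; simp)+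
    then show "?g l = (u mod p ^ i mod p ^ Suc l - u mod p ^ i mod p ^ l) * (t - c l)"
      by (simp add: mod_mod_cancel)
  qed
  moreover have "p ^ (i + s) dvd (\<Sum>l=i..<k. ?g l)"
  proof (rule dvd_sum)
    fix l assume l: "l \<in> {i..<k}"
    have "p ^ l dvd u mod p ^ Suc l - u mod p ^ l"
    proof -
      have "u mod p ^ l = u mod p ^ Suc l mod p ^ l" by (simp add: mod_mod_cancel)
      then show ?thesis by (metis dvd_minus_mod)
    qed
    moreover have "p ^ (i + s - l) dvd t - c l"
      using l win[of "l - i"] by (cases "l < i + s") (auto simp: add.commute)
    ultimately have "p ^ l * p ^ (i + s - l) dvd ?g l" by (rule mult_dvd_mono)
    moreover have "p ^ (i + s) dvd p ^ l * p ^ (i + s - l)"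
      by (simp add: power_add[symmetric] le_imp_power_dvd)
    ultimately show "p ^ (i + s) dvd ?g l" by (rule dvd_trans[rotated])
  qed
  ultimately show ?thesis by (simp add: mod_eq_dvd_iff)
qed

lemma card_le_card_residues:
  fixes A :: "int set" and a b :: int
  assumes A: "A \<subseteq> {0..<a * b}" and "a > 0" "b \<ge> 0" and "finite B" "(\<lambda>x. x mod a) ` A \<subseteq> B"
  shows "card A \<le> card B * nat b"
proof -
  have "x div a < b" if "x \<in> A" for x
  proof -
    have "a * (x div a) \<le> x" using assms(2) by (simp add: minus_mod_eq_mult_div[symmetric])
    also have "x < a * b" using A that by auto
    finally show ?thesis using assms(2) by simp
  qed
  then have "(\<lambda>x. (x mod a, x div a)) ` A \<subseteq> B \<times> {0..<b}"
    using assms by (auto simp: pos_imp_zdiv_nonneg_iff)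
  moreover have "inj_on (\<lambda>x. (x mod a, x div a)) A"
    by (rule inj_onI) (metis Pair_inject div_mult_mod_eq)
  ultimately have "card A \<le> card (B \<times> {0..<b})"
    using assms(4) by (intro card_inj_on_le[where f = "\<lambda>x. (x mod a, x div a)"]) auto
  then show ?thesis by (simp add: card_cartesian_product)
qed

text \<open>Modulo \<open>p ^ (i + s)\<close> the image has at most as many elements as there are
  residues \<open>u mod p ^ i\<close>, and each lifts in \<open>p ^ (k - (i + s))\<close> ways
  modulo \<open>p ^ k\<close>. The set \<open>U\<close> is arbitrary so that the multiples of
  \<open>p\<close> are covered too.\<close>

lemma card_digit_shear_image:
  fixes p :: nat
  assumes "p > 0" "i + s \<le> k" and win: "\<And>r. r < s \<Longrightarrow> int p ^ (s - r) dvd t - c (i + r)"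
  shows "card ((\<lambda>u. digit_shear p c k t u mod int p ^ k) ` U)
    \<le> card ((\<lambda>u. u mod int p ^ i) ` U) * p ^ (k - (i + s))"
proof -
  let ?I = "(\<lambda>u. digit_shear p c k t u mod int p ^ k) ` U"
  let ?V = "(\<lambda>u. u mod int p ^ i) ` U"
  let ?B = "(\<lambda>v. digit_shear p c i t v mod int p ^ (i + s)) ` ?V"
  have "?V \<subseteq> {0..<int p ^ i}" using assms(1) by auto
  then have V: "finite ?V" by (rule finite_subset) simp
  have k: "int p ^ (i + s) * int p ^ (k - (i + s)) = int p ^ k"
    using assms(2) by (simp add: power_add[symmetric])
  have "int p ^ (i + s) dvd int p ^ k" using assms(2) by (rule le_imp_power_dvd)
  then have "(\<lambda>x. x mod int p ^ (i + s)) ` ?I \<subseteq> ?B"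
    using digit_shear_cong[OF assms(2) win] by (auto simp: mod_mod_cancel)
  then have "card ?I \<le> card ?B * nat (int p ^ (k - (i + s)))"
    using V assms(1) k by (intro card_le_card_residues[where a = "int p ^ (i + s)"]) auto
  also have "\<dots> \<le> card ?V * p ^ (k - (i + s))"
    using V by (intro mult_mono card_image_le) (auto simp: nat_power_eq)
  finally show ?thesis .
qed

lemma card_multiples_below:
  fixes p :: nat
  assumes "p > 0"
  shows "finite {v. 0 \<le> v \<and> v < int p ^ Suc i \<and> int p dvd v}"
    and "card {v. 0 \<le> v \<and> v < int p ^ Suc i \<and> int p dvd v} = p ^ i"
proof -
  have eq: "{v. 0 \<le> v \<and> v < int p ^ Suc i \<and> int p dvd v} = (*) (int p) ` {0..<int p ^ i}"
    using assms by (auto simp: dvd_def zero_le_mult_iff)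
  show "finite {v. 0 \<le> v \<and> v < int p ^ Suc i \<and> int p dvd v}" unfolding eq by simp
  have "inj_on ((*) (int p)) {0..<int p ^ i}" using assms by (auto intro: inj_onI)
  then show "card {v. 0 \<le> v \<and> v < int p ^ Suc i \<and> int p dvd v} = p ^ i"
    unfolding eq by (simp add: card_image nat_power_eq)
qed

text \<open>The sequence of window_sequence is shifted by one index: a window must start at a positive
  index for the restriction to multiples of p to gain a factor p.\<close>

lemma small_shear:
  fixes p s m k :: nat
  assumes p: "p > 0" and k: "k = (\<Sum>j\<le>s. p ^ j)" and m: "k = Suc (s + m)"
  shows "\<exists>\<phi> :: int \<Rightarrow> int. \<forall>t.
    card ((\<lambda>u. (\<phi> u + t * u) mod int p ^ k) ` {0..<int p ^ k}) \<le> p ^ Suc m \<and>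
    card ((\<lambda>u. (\<phi> u + t * u) mod int p ^ k) ` {u \<in> {0..<int p ^ k}. int p dvd u}) \<le> p ^ m"
proof -
  obtain c :: "nat \<Rightarrow> int"
    where c: "\<And>t. \<exists>i. i + s < k \<and> (\<forall>r<s. int p ^ (s - r) dvd t - c (i + r))"
    using window_sequence[OF p, of s] unfolding k by blast
  define c' where "c' l = c (l - 1)" for l
  define \<phi> where "\<phi> = digit_shear p c' k 0"
  have main: "card ((\<lambda>u. (\<phi> u + t * u) mod int p ^ k) ` {0..<int p ^ k}) \<le> p ^ Suc m \<and>
    card ((\<lambda>u. (\<phi> u + t * u) mod int p ^ k) ` {u \<in> {0..<int p ^ k}. int p dvd u}) \<le> p ^ m" for t
  proof -
    obtain i where "i + s < k" "\<forall>r<s. int p ^ (s - r) dvd t - c (i + r)"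
      using c by blast
    \<comment> \<open>As \<open>i + s < k\<close>, the shifted window, which starts at
      \<open>Suc i\<close>, still ends below \<open>k\<close>.\<close>
    then have i: "Suc i + s \<le> k" "\<And>r. r < s \<Longrightarrow> int p ^ (s - r) dvd t - c' (Suc i + r)"
      by (simp_all add: c'_def)
    have bound: "card ((\<lambda>u. (\<phi> u + t * u) mod int p ^ k) ` U)
      \<le> card ((\<lambda>u. u mod int p ^ Suc i) ` U) * p ^ (k - (Suc i + s))" if "U \<subseteq> {0..<int p ^ k}" for U
    proof -
      have "(\<lambda>u. (\<phi> u + t * u) mod int p ^ k) ` U = (\<lambda>u. digit_shear p c' k t u mod int p ^ k) ` U"
        unfolding \<phi>_def using that
        by (intro image_cong refl) (subst digit_shear_affine[where t = t], auto)
      then show ?thesis using card_digit_shear_image[OF p i] by simp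
    qed
    \<comment> \<open>\<open>Suc m\<close> is \<open>k - s\<close>: the start of the window, which
      varies with \<open>t\<close>, cancels from the bounds.\<close>
    have e: "p ^ Suc i * p ^ (k - (Suc i + s)) = p ^ Suc m" "p ^ i * p ^ (k - (Suc i + s)) = p ^ m"
      using i(1) m by (simp_all add: power_add[symmetric] del: power_Suc)
    have "card ((\<lambda>u. u mod int p ^ Suc i) ` {0..<int p ^ k}) \<le> card {0..<int p ^ Suc i}"
      using p by (intro card_mono) auto
    then have 1: "card ((\<lambda>u. u mod int p ^ Suc i) ` {0..<int p ^ k}) \<le> p ^ Suc i"
      by (simp add: nat_power_eq nat_mult_distrib)
    have "(\<lambda>u. u mod int p ^ Suc i) ` {u \<in> {0..<int p ^ k}. int p dvd u}
        \<subseteq> {v. 0 \<le> v \<and> v < int p ^ Suc i \<and> int p dvd v}"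
      using p by (auto simp: dvd_mod_iff simp del: power_Suc)
    then have 2: "card ((\<lambda>u. u mod int p ^ Suc i) ` {u \<in> {0..<int p ^ k}. int p dvd u}) \<le> p ^ i"
      using card_mono card_multiples_below[OF p] by metis
    have sub: "{0..<int p ^ k} \<subseteq> {0..<int p ^ k}" "{u \<in> {0..<int p ^ k}. int p dvd u} \<subseteq> {0..<int p ^ k}"
      by auto
    show ?thesis
      using order_trans[OF bound[OF sub(1)] mult_right_mono[OF 1 zero_le]]
        order_trans[OF bound[OF sub(2)] mult_right_mono[OF 2 zero_le]]
      unfolding e by (rule conjI)
  qed
  then show ?thesis by blast
qed

section \<open>The Kakeya set and its size\<close>

text \<open>With images of \<open>\<phi> u + t * u\<close> as \<open>A t\<close> and
  \<open>B t\<close>, this contains the lines chosen for the directions with last unit coordinate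
  \<open>j\<close>. Letting the other coordinates vary independently for fixed \<open>t\<close>
  makes each slice a product, which is easy to count.\<close>

definition shear_set ::
    "int \<Rightarrow> nat \<Rightarrow> (int \<Rightarrow> int set) \<Rightarrow> (int \<Rightarrow> int set) \<Rightarrow> nat \<Rightarrow> (nat \<Rightarrow> int) set" where
  "shear_set N n A B j = (\<Union>t\<in>{0..<N}.
     Pi\<^sub>E {..<n} (\<lambda>i. if i = j then {t} else if i < j then A t else B t))"

lemma card_shear_set:
  assumes "0 \<le> N" "j < n" and A: "\<And>t. card (A t) \<le> a" and B: "\<And>t. card (B t) \<le> b"
  shows "card (shear_set N n A B j) \<le> nat N * (a ^ j * b ^ (n - Suc j))"
proof -
  have "card (Pi\<^sub>E {..<n} (\<lambda>i. if i = j then {t} else if i < j then A t else B t))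
      \<le> a ^ j * b ^ (n - Suc j)" for t
  proof -
    let ?f = "\<lambda>i. card (if i = j then {t} else if i < j then A t else B t)"
    have "{..<n} = insert j ({..<j} \<union> {Suc j..<n})" using assms(2) by auto
    then have "(\<Prod>i<n. ?f i) = (\<Prod>i\<in>insert j ({..<j} \<union> {Suc j..<n}). ?f i)" by simp
    also have "\<dots> = (\<Prod>i<j. ?f i) * (\<Prod>i=Suc j..<n. ?f i)"
      by (simp add: prod.union_disjoint disjoint_iff)
    also have "\<dots> = card (A t) ^ j * card (B t) ^ (n - Suc j)" by simp
    also have "\<dots> \<le> a ^ j * b ^ (n - Suc j)" using A B by (intro mult_mono power_mono) auto
    finally show ?thesis by (simp add: card_PiE)
  qed
  then have "card (shear_set N n A B j) \<le> (\<Sum>t\<in>{0..<N}. a ^ j * b ^ (n - Suc j))"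
    unfolding shear_set_def by (intro order_trans[OF card_UN_le] sum_mono) auto
  then show ?thesis by simp
qed

lemma Units_prime_power_residue_ring:
  assumes "prime p" "k > 0" "x \<in> carrier (residue_ring (int (p ^ k)))"
  shows "x \<in> Units (residue_ring (int (p ^ k))) \<longleftrightarrow> \<not> int p dvd x"
proof -
  have "int (p ^ k) > 1" using assms by (metis nat_int_comparison(2) of_nat_1 one_less_power prime_gt_1_nat)
  then interpret residues "int (p ^ k)" "residue_ring (int (p ^ k))" by unfold_locales auto
  have "coprime x (int (p ^ k)) \<longleftrightarrow> \<not> int p dvd x"
  proof
    assume "coprime x (int (p ^ k))"
    then have "coprime x (int p)" using assms(2) by simp
    then show "\<not> int p dvd x" using assms(1)
      by (metis coprime_common_divisor dvd_refl not_prime_unit prime_nat_int_transfer)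
  next
    assume "\<not> int p dvd x"
    then have "coprime (int p) x" using assms(1) by (intro prime_imp_coprime) auto
    then show "coprime x (int (p ^ k))" by (simp add: coprime_commute)
  qed
  moreover have "0 \<le> x" "x < int (p ^ k)" using assms(3) by (auto simp: residue_ring_def)
  moreover have "x \<noteq> 0" if "\<not> int p dvd x" using that by auto
  ultimately show ?thesis unfolding res_units_eq by auto
qed

lemma is_kakeya_set_shear:
  fixes \<phi> :: "int \<Rightarrow> int"
  assumes p: "prime p" "k > 0"
  defines "N \<equiv> int p ^ k"
  shows "is_kakeya_set (residue_ring (int (p ^ k))) n
    (\<Union>j<n. shear_set N n
       (\<lambda>t. (\<lambda>u. (\<phi> u + t * u) mod N) ` {0..<N})
       (\<lambda>t. (\<lambda>u. (\<phi> u + t * u) mod N) ` {u \<in> {0..<N}. int p dvd u}) j)"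
    (is "is_kakeya_set _ _ (\<Union>j<n. shear_set _ _ ?A ?B j)")
proof -
  have N: "int (p ^ k) = N" by (simp add: N_def)
  have N1: "N > 1" using p unfolding N[symmetric]
    by (metis nat_int_comparison(2) of_nat_1 one_less_power prime_gt_1_nat)
  define R where "R = residue_ring N"
  interpret residues N R using N1 by unfold_locales (auto simp: R_def)
  have car: "carrier R = {0..<N}" by (auto simp: R_def residue_ring_def)
  have mul: "x \<otimes>\<^bsub>R\<^esub> y = x * y mod N" for x y by (simp add: R_def residue_ring_def)
  have add: "x \<oplus>\<^bsub>R\<^esub> y = (x + y) mod N" for x y by (simp add: R_def residue_ring_def)
  have units: "x \<in> Units R \<longleftrightarrow> \<not> int p dvd x" if "x \<in> carrier R" for x
    using Units_prime_power_residue_ring[OF p, of x] that unfolding R_def N by simp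
  have "\<exists>L. is_line_in_direction R n D L \<and> L \<subseteq> (\<Union>j<n. shear_set N n ?A ?B j)"
    if dir: "D \<in> directions R n" for D
  proof -
    obtain u where u: "u \<in> unit_coord_vectors R n" and D: "D = same_direction R n `` {u}"
      using dir unfolding directions_def by (rule quotientE)
    have uc: "u i \<in> carrier R" if "i < n" for i
      using u that by (auto simp: unit_coord_vectors_def vectors_def)
    \<comment> \<open>Taking the last unit coordinate makes all later ones multiples of
      \<open>p\<close>, which puts them in the smaller sets \<open>?B\<close>.\<close>
    define j where "j = (GREATEST j. j < n \<and> u j \<in> Units R)"
    have "\<exists>i. i < n \<and> u i \<in> Units R" using u by (auto simp: unit_coord_vectors_def)
    then have j: "j < n" "u j \<in> Units R"
      unfolding j_def by (metis (mono_tags, lifting) GreatestI_nat less_imp_le)+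
    have last: "int p dvd u i" if "j < i" "i < n" for i
    proof -
      have "u i \<notin> Units R"
        using Greatest_le_nat[of "\<lambda>j. j < n \<and> u j \<in> Units R" i n] that
        unfolding j_def[symmetric] by auto
      then show ?thesis using units[OF uc[OF that(2)]] by simp
    qed
    define d where "d = inv\<^bsub>R\<^esub> (u j)"
    have d: "d \<in> Units R" using j by (simp add: d_def)
    define v where "v = vec_scale R n d u"
    have v: "v i = d * u i mod N" if "i < n" for i using that by (simp add: v_def vec_scale_def mul)
    have vj: "v j = 1"
    proof -
      have "v j = d \<otimes>\<^bsub>R\<^esub> u j" using j by (simp add: v_def vec_scale_def)
      also have "\<dots> = \<one>\<^bsub>R\<^esub>" unfolding d_def using j(2) by (rule Units_l_inv)
      finally show ?thesis by (simp add: res_one_eq)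
    qed
    have vc: "v i \<in> {0..<N}" if "i < n" for i using v[OF that] N1 by simp
    have vlast: "int p dvd v i" if "j < i" "i < n" for i
    proof -
      have "int p dvd N" using p by (simp add: N_def)
      then show ?thesis using last[OF that] v[OF that(2)] by (simp add: dvd_mod_iff)
    qed
    have "v \<in> vectors R n" using vc by (auto simp: vectors_def car v_def vec_scale_def)
    then have "v \<in> unit_coord_vectors R n"
      using vj j by (auto simp: unit_coord_vectors_def intro!: exI[of _ j]) (metis Units_one_closed one_cong res_one_eq)
    then have "v \<in> D" using u d by (auto simp: D same_direction_def v_def)
    \<comment> \<open>Coordinate \<open>j\<close> of \<open>a\<close> is 0 and
      \<open>v j = 1\<close>, so coordinate \<open>j\<close> of a point on the line is its parameter
      and names the slice containing it.\<close>
    define a where "a = (\<lambda>i\<in>{..<n}. if i = j then 0 else \<phi> (v i) mod N)"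
    have "a \<in> vectors R n" using N1 by (auto simp: a_def vectors_def car)
    then have "is_line_in_direction R n D (line R n a v)"
      using \<open>v \<in> D\<close> unfolding is_line_in_direction_def by blast
    moreover have "line R n a v \<subseteq> shear_set N n ?A ?B j"
    proof
      fix x assume "x \<in> line R n a v"
      then obtain l where l: "l \<in> {0..<N}" and x: "x = vec_add R n a (vec_scale R n l v)"
        by (auto simp: line_def car)
      have "x j = l" using l j by (simp add: x vec_add_def vec_scale_def a_def mul add vj)
      moreover have "x i = (\<phi> (v i) + l * v i) mod N" if "i < n" "i \<noteq> j" for i
        using that by (simp add: x vec_add_def vec_scale_def a_def mul add mod_simps)
      moreover have "x \<in> extensional {..<n}" by (simp add: x vec_add_def)
      ultimately have "x \<in> Pi\<^sub>E {..<n} (\<lambda>i. if i = j then {l} else if i < j then ?A l else ?B l)"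
        using vc vlast by (auto simp: PiE_iff)
      then show "x \<in> shear_set N n ?A ?B j" 
        unfolding shear_set_def using l by (rule UN_I[rotated])
    qed
    ultimately show ?thesis using j(1) by blast
  qed
  moreover have "shear_set N n ?A ?B j \<subseteq> vectors R n" for j
  proof -
    have "?A t \<subseteq> {0..<N}" "?B t \<subseteq> {0..<N}" for t using N1 by auto
    then show ?thesis
      unfolding shear_set_def vectors_def car by (intro UN_least PiE_mono) auto
  qed
  ultimately show ?thesis unfolding is_kakeya_set_def N R_def[symmetric] by blast
qed

section \<open>The final estimate\<close>

theorem theorem1p11:
  fixes s n p k :: nat
  assumes "prime p" and "p \<ge> 3"
    and "k = (p ^ (s + 1) - 1) div (p - 1)"
  shows "\<exists>S. is_kakeya_set (residue_ring (int (p ^ k))) n S \<and>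
           real (card S) \<le> real p ^ (k * n) / real k powi (int n - 1) * (1 - 1 / real p) powi (- int n)"
proof -
  have p: "p > 1" using assms(2) by simp
  have geo: "(p - 1) * (\<Sum>j<m. p ^ j) = p ^ m - 1" for m
  proof -
    obtain q where "p = Suc q" using p by (cases p) auto
    moreover have "q * (\<Sum>j<m. Suc q ^ j) + 1 = Suc q ^ m"
      by (induction m) (simp_all add: algebra_simps)
    ultimately show ?thesis by (metis diff_Suc_1 diff_add_inverse2)
  qed
  have k: "k = (\<Sum>j\<le>s. p ^ j)"
    using geo[of "Suc s"] p assms(3) by (simp add: lessThan_Suc_atMost del: power_Suc)
      (metis nonzero_mult_div_cancel_left zero_less_diff less_numeral_extra(3) Suc_eq_plus1)
  have "(\<Sum>j\<le>s. 1) \<le> k" unfolding k using p by (intro sum_mono) simp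
  then have "Suc s \<le> k" by simp
  then obtain m where m: "k = Suc (s + m)" by (metis less_eq_Suc_le less_imp_Suc_add)
  define N where "N = int p ^ k"
  obtain \<phi> :: "int \<Rightarrow> int" where
    \<phi>: "\<And>t. card ((\<lambda>u. (\<phi> u + t * u) mod N) ` {0..<N}) \<le> p ^ Suc m"
      "\<And>t. card ((\<lambda>u. (\<phi> u + t * u) mod N) ` {u \<in> {0..<N}. int p dvd u}) \<le> p ^ m"
    using small_shear[OF _ k m] p unfolding N_def by auto
  let ?T = "shear_set N n (\<lambda>t. (\<lambda>u. (\<phi> u + t * u) mod N) ` {0..<N})
       (\<lambda>t. (\<lambda>u. (\<phi> u + t * u) mod N) ` {u \<in> {0..<N}. int p dvd u})"
  let ?S = "\<Union>j<n. ?T j"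
  have kak: "is_kakeya_set (residue_ring (int (p ^ k))) n ?S"
    unfolding N_def using assms(1) m by (intro is_kakeya_set_shear) auto
  have "real (card ?S) \<le> real p ^ (k * n) / real k powi (int n - 1) * (1 - 1 / real p) powi (- int n)"
  proof (cases n)
    case 0
    then show ?thesis by simp
  next
    case (Suc n')
    have "card ?S \<le> (\<Sum>j<n. card (?T j))" by (rule card_UN_le) simp
    also have "\<dots> \<le> (\<Sum>j<n. nat N * ((p ^ Suc m) ^ j * (p ^ m) ^ (n - Suc j)))"
      using \<phi> by (intro sum_mono card_shear_set) (auto simp: N_def)
    also have "\<dots> = (\<Sum>j<n. p ^ k * (p ^ m) ^ n' * p ^ j)"
    proof (rule sum.cong[OF refl])
      fix j assume "j \<in> {..<n}"
      then have "n' = j + (n - Suc j)" using Suc by auto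
      then have "(p ^ m) ^ n' = (p ^ m) ^ j * (p ^ m) ^ (n - Suc j)" by (metis power_add)
      then show "nat N * ((p ^ Suc m) ^ j * (p ^ m) ^ (n - Suc j)) = p ^ k * (p ^ m) ^ n' * p ^ j"
        by (simp add: N_def nat_power_eq power_mult_distrib)
    qed
    finally have "(p - 1) * card ?S \<le> p ^ k * (p ^ m) ^ n' * ((p - 1) * (\<Sum>j<n. p ^ j))"
      by (simp add: sum_distrib_left[symmetric] mult.left_commute)
    also have "\<dots> \<le> p ^ k * (p ^ m) ^ n' * p ^ n" unfolding geo by simp
    \<comment> \<open>Each of the \<open>n'\<close> factors \<open>p ^ m\<close> takes one
      \<open>p\<close> from \<open>p ^ n\<close>, which leaves one over.\<close>
    also have "\<dots> = p ^ k * (p ^ Suc m) ^ n' * p" by (simp add: Suc power_mult_distrib)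
    finally have "real ((p - 1) * card ?S) \<le> real (p ^ k * (p ^ Suc m) ^ n' * p)"
      by (rule of_nat_mono)
    then have S: "real (card ?S) \<le> real p ^ k * (real p ^ Suc m) ^ n' * (p / (real p - 1))"
      using p by (simp add: of_nat_diff field_simps)
    \<comment> \<open>The number \<open>k\<close> of tree nodes is at most
      \<open>p ^ s * p / (p - 1)\<close>, so \<open>p ^ (k - s)\<close> exceeds
      \<open>p ^ k / k\<close> by at most the factor \<open>p / (p - 1)\<close>. The
      \<open>n'\<close> such factors and the one in \<open>S\<close> make up the exponent
      \<open>n\<close>.\<close>
    have "k * (p - 1) \<le> p ^ Suc s"
      using geo[of "Suc s"] k by (simp add: lessThan_Suc_atMost mult.commute del: power_Suc)
    then have "real (k * (p - 1)) \<le> real (p ^ Suc s)" by (rule of_nat_mono)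
    then have "real k \<le> real p ^ s * (p / (real p - 1))"
      using p by (simp add: of_nat_diff field_simps)
    moreover have k0: "real k > 0" using m by simp
    ultimately have ge1: "1 \<le> real p ^ s * (p / (real p - 1)) / k"
      by (metis le_divide_eq_1_pos)
    then have "real p ^ Suc m \<le> real p ^ Suc m * (real p ^ s * (p / (real p - 1)) / k)"
      using mult_left_mono[OF ge1, of "real p ^ Suc m"] by simp
    also have "\<dots> = real p ^ k / k * (p / (real p - 1))"
      by (simp add: m power_add mult.commute mult.left_commute)
    finally have "(real p ^ Suc m) ^ n' \<le> (real p ^ k / k * (p / (real p - 1))) ^ n'"
      by (rule power_mono) simp
    then have "real p ^ k * (real p ^ Suc m) ^ n' * (p / (real p - 1))
        \<le> real p ^ k * (real p ^ k / k * (p / (real p - 1))) ^ n' * (p / (real p - 1))"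
      using p by (intro mult_right_mono mult_left_mono) auto
    also have "\<dots> = real p ^ (k * n) / real k ^ n' * (p / (real p - 1)) ^ n"
      by (simp add: Suc power_mult power_mult_distrib power_divide power_add ac_simps)
    also have "(p / (real p - 1)) ^ n = (1 - 1 / real p) powi (- int n)"
    proof -
      have "p / (real p - 1) = inverse (1 - 1 / real p)" using p by (simp add: field_simps)
      then show ?thesis by (simp only: power_int_minus power_int_of_nat power_inverse)
    qed
    also have "real k ^ n' = real k powi (int n - 1)" by (simp add: Suc)
    finally show ?thesis using S by linarith
  qed
  with kak show ?thesis by blast
qed

end
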